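(* Let $F$ be a clause-set with all clauses of length $1$ or $2$, and let $\{x\},\{y\} \in F$ be two different unit-clauses. Then the map $P \mapsto F(P) := \mathcal{CL}(E(P)) \cup \{\{x\},\{y\}\}$ is a bijection from the set $\mathfrak R_{x,\overline y}(\mathrm{idg}(F))$ of regular paths from $x$ to $\overline y$ in $\mathrm{idg}(F)$ onto the set of minimally unsatisfiable subsets of $F$ containing both $\{x\}$ and $\{y\}$.
   Context: Literals are variables and complements ($\overline{\overline x}=x$); a clause is a finite set of literals without complementary pair; $F$ is a finite set of clauses. A clause-set is minimally unsatisfiable if unsatisfiable and every proper subset obtained by removing one clause is satisfiable. The implication digraph $\mathrm{idg}(F)$ has as vertices all literals whose variable occurs in $F$; for each binary clause $\{a,b\}\in F$ it has arcs $(\overline a,b)$ and $(\overline b,a)$, and for each unit-clause $\{a\}$ the arc $(\overline a, a)$. For a set $A$ of arcs, $\mathcal{CL}(A)=\{\{\overline a,b\} : (a,b)\in A\}$ (so an arc $(\overline a,a)$ gives the unit-clause $\{a\}$). A path is a directed path with pairwise distinct vertices (considered as a subdigraph); it is regular if its vertex set contains no pair of complementary literals. *)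

theory Defs
  imports "Graph_Theory.Pair_Digraph"
begin

datatype 'v lit = Pos (var: 'v) | Neg (var: 'v)

primrec compl :: "'v lit \<Rightarrow> 'v lit" where
  "compl (Pos v) = Neg v"
| "compl (Neg v) = Pos v"

lemma compl_compl [simp]: "compl (compl l) = l"
  by (cases l) simp_all

type_synonym 'v clause = "'v lit set"
type_synonym 'v clause_set = "'v clause set"

definition complement_free :: "'v lit set \<Rightarrow> bool" where
  "complement_free L \<longleftrightarrow> (\<forall>l\<in>L. compl l \<notin> L)"

definition is_clause :: "'v clause \<Rightarrow> bool" where
  "is_clause C \<longleftrightarrow> finite C \<and> complement_free C"

definition is_clause_set :: "'v clause_set \<Rightarrow> bool" where
  "is_clause_set F \<longleftrightarrow> finite F \<and> (\<forall>C\<in>F. is_clause C)"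

definition vars :: "'v clause_set \<Rightarrow> 'v set" where
  "vars F = var ` (\<Union>F)"

primrec lit_true :: "('v \<Rightarrow> bool) \<Rightarrow> 'v lit \<Rightarrow> bool" where
  "lit_true \<tau> (Pos v) \<longleftrightarrow> \<tau> v"
| "lit_true \<tau> (Neg v) \<longleftrightarrow> \<not> \<tau> v"

definition satisfiable :: "'v clause_set \<Rightarrow> bool" where
  "satisfiable F \<longleftrightarrow> (\<exists>\<tau>. \<forall>C\<in>F. \<exists>l\<in>C. lit_true \<tau> l)"

definition minimally_unsat :: "'v clause_set \<Rightarrow> bool" where
  "minimally_unsat F \<longleftrightarrow> \<not> satisfiable F \<and> (\<forall>C\<in>F. satisfiable (F - {C}))"

text \<open>Both arcs of a binary clause come from the same comprehension, since
  \<open>{a, b} = {b, a}\<close>.\<close>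

definition idg :: "'v clause_set \<Rightarrow> 'v lit pair_pre_digraph" where
  "idg F = \<lparr> pverts = {l. var l \<in> vars F},
             parcs = {(compl a, b) | a b. a \<noteq> b \<and> {a, b} \<in> F}
                   \<union> {(compl a, a) | a. {a} \<in> F} \<rparr>"

definition CL :: "'v lit rel \<Rightarrow> 'v clause_set" where
  "CL A = {{compl a, b} | a b. (a, b) \<in> A}"

text \<open>The library represents a path by its list of arcs; here it is turned into the
  subdigraph it traverses. The start vertex is needed for the path without arcs.\<close>

definition walk_digraph :: "'a \<Rightarrow> ('a \<times> 'a) awalk \<Rightarrow> 'a pair_pre_digraph" where
  "walk_digraph u p = \<lparr> pverts = set (pawalk_verts u p), parcs = set p \<rparr>"

definition paths :: "'a pair_pre_digraph \<Rightarrow> 'a \<Rightarrow> 'a \<Rightarrow> 'a pair_pre_digraph set" where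
  "paths G u v = {walk_digraph u p | p. pre_digraph.apath (with_proj G) u p v}"

definition regular_paths ::
    "'v lit pair_pre_digraph \<Rightarrow> 'v lit \<Rightarrow> 'v lit \<Rightarrow> 'v lit pair_pre_digraph set" where
  "regular_paths G u v = {P \<in> paths G u v. complement_free (pverts P)}"

end

theory Submission
  imports Defs
begin

text \<open>
  A regular path from \<open>x\<close> to \<open>compl y\<close> spells out a chain of implications refuted by the
  unit clauses \<open>{x}\<close> and \<open>{y}\<close>; dropping an arc cuts the path, and making exactly
  the vertices before the cut true satisfies the remaining clauses. The path is recovered from its
  clauses because regularity leaves only one usable orientation for each clause.

  Conversely, let \<open>G\<close> be minimally unsatisfiable with \<open>{x}, {y} \<in> G\<close>, and let \<open>R\<close> be
  the set of literals reachable from \<open>x\<close> in the implication digraph of \<open>G - {{y}}\<close>. A model of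
  \<open>G - {{y}}\<close> makes all of \<open>R\<close> true, so \<open>R\<close> contains no complementary pair. If
  \<open>compl y \<notin> R\<close>, then a model of \<open>G - {{x}}\<close>, modified to make \<open>R\<close> true, would
  satisfy \<open>G\<close>. Hence there is a path from \<open>x\<close> to \<open>compl y\<close> inside \<open>R\<close>;
  it is automatically regular, and minimality forces its clauses to exhaust \<open>G\<close>.
\<close>

section \<open>Valuations, satisfiability and the implication digraph\<close>

lemma lit_true_compl [simp]: "lit_true \<tau> (compl l) \<longleftrightarrow> \<not> lit_true \<tau> l"
  by (cases l) simp_all

lemma var_compl [simp]: "var (compl l) = var l"
  by (cases l) simp_all

text \<open>As \<open>V\<close> holds at most one literal of each variable, truth on
  \<open>V\<close> can be prescribed freely through \<open>S\<close>, with \<open>\<sigma>\<close>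
  as the default elsewhere. \<open>S\<close> marks the true side of a cut path in one use and is all
  of \<open>V\<close> in the other.\<close>

lemma ex_valuation_override:
  assumes "complement_free V"
  obtains \<tau> where "\<And>l. l \<in> V \<Longrightarrow> lit_true \<tau> l \<longleftrightarrow> l \<in> S"
    and "\<And>l. l \<notin> V \<Longrightarrow> compl l \<notin> V \<Longrightarrow> lit_true \<tau> l \<longleftrightarrow> lit_true \<sigma> l"
proof
  define \<tau> where
    "\<tau> v = (if Pos v \<in> V then Pos v \<in> S else if Neg v \<in> V then Neg v \<notin> S else \<sigma> v)" for v
  have "Pos v \<notin> V" if "Neg v \<in> V" for v
    using assms that unfolding complement_free_def by (metis compl.simps(2))
  then show "lit_true \<tau> l \<longleftrightarrow> l \<in> S" if "l \<in> V" for l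
    using that by (cases l) (simp_all add: \<tau>_def)
  show "lit_true \<tau> l \<longleftrightarrow> lit_true \<sigma> l" if "l \<notin> V" "compl l \<notin> V" for l
    using that by (cases l) (simp_all add: \<tau>_def)
qed

lemma satisfiable_mono: "H \<subseteq> G \<Longrightarrow> satisfiable G \<Longrightarrow> satisfiable H"
  unfolding satisfiable_def by (meson subsetD)

text \<open>The definition only speaks of dropping one clause; since satisfiability passes to
  subsets, it rules out every unsatisfiable proper subset.\<close>

lemma minimally_unsat_subset_eq:
  assumes "minimally_unsat G" "H \<subseteq> G" "\<not> satisfiable H"
  shows "H = G"
proof (rule ccontr)
  assume "H \<noteq> G"
  then obtain C where "C \<in> G" "H \<subseteq> G - {C}"
    using assms(2) by auto
  then show False
    using assms(1,3) satisfiable_mono unfolding minimally_unsat_def by auto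
qed

text \<open>The choice \<open>a = b\<close> covers the arcs of the unit clauses.\<close>

lemma parcs_idg: "parcs (idg F) = {(compl a, b) | a b. {a, b} \<in> F}"
proof (intro set_eqI iffI)
  fix e assume "e \<in> parcs (idg F)"
  then show "e \<in> {(compl a, b) | a b. {a, b} \<in> F}"
    unfolding idg_def by (force simp: insert_absorb2)
next
  fix e assume "e \<in> {(compl a, b) | a b. {a, b} \<in> F}"
  then obtain a b where "e = (compl a, b)" "{a, b} \<in> F"
    by blast
  then show "e \<in> parcs (idg F)"
    unfolding idg_def by (cases "a = b") auto
qed

lemma CL_parcs_idg_subset: "CL (parcs (idg F)) \<subseteq> F"
  by (auto simp: CL_def parcs_idg)

lemma CL_mono: "A \<subseteq> B \<Longrightarrow> CL A \<subseteq> CL B"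
  by (auto simp: CL_def)

lemma pair_wf_digraph_idg: "pair_wf_digraph (idg F)"
proof
  have "var a \<in> vars F" "var b \<in> vars F" if "{a, b} \<in> F" for a b
    using that by (force simp: vars_def)+
  moreover have "pverts (idg F) = {l. var l \<in> vars F}"
    by (simp add: idg_def)
  ultimately show "fst e \<in> pverts (idg F)" "snd e \<in> pverts (idg F)"
    if "e \<in> parcs (idg F)" for e
    using that by (auto simp: parcs_idg)
qed

lemma idg_mono:
  assumes "G \<subseteq> F"
  shows "pverts (idg G) \<subseteq> pverts (idg F)" "parcs (idg G) \<subseteq> parcs (idg F)"
proof -
  show "pverts (idg G) \<subseteq> pverts (idg F)"
    using assms by (auto simp: idg_def vars_def)
  show "parcs (idg G) \<subseteq> parcs (idg F)"
    using assms unfolding parcs_idg by blast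
qed

section \<open>Paths as lists of arcs\<close>

text \<open>Only the first two conditions mention \<open>G\<close>, so a path carries over to any
  digraph with more vertices and arcs.\<close>

lemma apath_with_proj_iff:
  "pre_digraph.apath (with_proj G) u p v \<longleftrightarrow>
     u \<in> pverts G \<and> set p \<subseteq> parcs G \<and> pcas u p v \<and> distinct (pawalk_verts u p)"
  by (simp add: pre_digraph.apath_def pre_digraph.awalk_def cas_with_proj_eq
      awalk_verts_with_proj_eq conj_assoc)

lemma regular_pathE:
  assumes "P \<in> regular_paths G u v"
  obtains p where "P = walk_digraph u p" "set p \<subseteq> parcs G" "pcas u p v"
    "distinct (pawalk_verts u p)" "complement_free (set (pawalk_verts u p))"
  using assms
  by (auto simp: regular_paths_def paths_def apath_with_proj_iff walk_digraph_def)

lemma start_in_pawalk_verts: "pcas u p v \<Longrightarrow> u \<in> set (pawalk_verts u p)"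
  by (cases p) auto

lemma end_in_pawalk_verts: "pcas u p v \<Longrightarrow> v \<in> set (pawalk_verts u p)"
  by (induction u p v rule: pcas.induct) auto

lemma arc_in_pawalk_verts:
  assumes "pcas u p v" "(a, b) \<in> set p"
  shows "a \<in> set (pawalk_verts u p)" "b \<in> set (pawalk_verts u p)"
  using assms by (induction u p v rule: pcas.induct) (auto dest: start_in_pawalk_verts)

text \<open>The cut arc contributes no vertex of its own, since \<open>a\<close> closes the first
  part and \<open>b\<close> opens the second. Distinctness of the whole list thus makes the two
  parts disjoint.\<close>

lemma pcas_append_Cons:
  assumes "pcas u (p @ (a, b) # q) v"
  shows "pcas u p a" "pcas b q v"
    "pawalk_verts u (p @ (a, b) # q) = pawalk_verts u p @ pawalk_verts b q"
  using assms by (induction p arbitrary: u) auto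

section \<open>From regular paths to minimally unsatisfiable clause-sets\<close>

lemma lit_true_along_walk:
  assumes "pcas u p v" "lit_true \<tau> u" "\<forall>C\<in>CL (set p). \<exists>l\<in>C. lit_true \<tau> l"
  shows "lit_true \<tau> v"
  using assms
proof (induction u p v rule: pcas.induct)
  case (2 u e p v)
  obtain b where e: "e = (u, b)"
    using 2(2) by (cases e) auto
  have "{compl u, b} \<in> CL (set (e # p))"
    by (auto simp: CL_def e)
  then have "\<exists>l\<in>{compl u, b}. lit_true \<tau> l"
    using 2(4) by blast
  then have "lit_true \<tau> b"
    using 2(3) by simp
  moreover have "CL (set p) \<subseteq> CL (set (e # p))"
    by (rule CL_mono) auto
  ultimately show ?case
    using 2 e by auto
qed simp

lemma path_clauses_unsat:
  assumes "pcas x p (compl y)"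
  shows "\<not> satisfiable (CL (set p) \<union> {{x}, {y}})"
proof
  assume "satisfiable (CL (set p) \<union> {{x}, {y}})"
  then obtain \<tau> where \<tau>: "\<forall>C\<in>CL (set p) \<union> {{x}, {y}}. \<exists>l\<in>C. lit_true \<tau> l"
    unfolding satisfiable_def by blast
  then have "\<forall>C\<in>CL (set p). \<exists>l\<in>C. lit_true \<tau> l" "lit_true \<tau> x" "lit_true \<tau> y"
    by simp_all
  then show False
    using lit_true_along_walk[OF assms, of \<tau>] by simp
qed

lemma path_clauses_minimally_unsat:
  assumes walk: "pcas x p (compl y)"
    and dist: "distinct (pawalk_verts x p)"
    and reg: "complement_free (set (pawalk_verts x p))"
  shows "minimally_unsat (CL (set p) \<union> {{x}, {y}})"
proof -
  let ?F = "CL (set p) \<union> {{x}, {y}}" and ?V = "set (pawalk_verts x p)"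
  have ends: "x \<in> ?V" "compl y \<in> ?V"
    using walk by (auto intro: start_in_pawalk_verts end_in_pawalk_verts)
  \<comment> \<open>Vertices in \<open>S\<close> are made true, all others false. Arcs must not
    leave \<open>S\<close>, \<open>x\<close> must lie inside and \<open>compl y\<close> outside;
    each demand lapses when its clause is the dropped \<open>C\<close>.\<close>
  have cut: "satisfiable (?F - {C})"
    if arcs: "\<And>a b. (a, b) \<in> set p \<Longrightarrow> {compl a, b} \<noteq> C \<Longrightarrow> a \<in> S \<Longrightarrow> b \<in> S"
      and x: "{x} \<noteq> C \<Longrightarrow> x \<in> S" and y: "{y} \<noteq> C \<Longrightarrow> compl y \<notin> S" for C S
  proof -
    obtain \<tau> where \<tau>: "\<And>l. l \<in> ?V \<Longrightarrow> lit_true \<tau> l \<longleftrightarrow> l \<in> S"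
      using ex_valuation_override[OF reg, where S = S] by blast
    have "\<exists>l\<in>D. lit_true \<tau> l" if "D \<in> ?F - {C}" for D
    proof -
      consider a b where "(a, b) \<in> set p" "D = {compl a, b}" | "D = {x}" | "D = {y}"
        using \<open>D \<in> ?F - {C}\<close> by (auto simp: CL_def)
      then show ?thesis
      proof cases
        case (1 a b)
        then have "a \<in> S \<longrightarrow> b \<in> S"
          using arcs that by blast
        then have "lit_true \<tau> (compl a) \<or> lit_true \<tau> b"
          using \<tau> arc_in_pawalk_verts[OF walk 1(1)] by simp
        then show ?thesis
          using 1(2) by blast
      next
        case 2
        then show ?thesis
          using x \<tau> ends that by auto
      next
        case 3
        then show ?thesis
          using y \<tau>[of "compl y"] ends that by auto
      qed
    qed
    then show ?thesis
      unfolding satisfiable_def by blast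
  qed
  have "satisfiable (?F - {C})" if "C \<in> ?F" for C
  proof -
    consider (arc) a b where "(a, b) \<in> set p" "C = {compl a, b}" | (x) "C = {x}" | (y) "C = {y}"
      using \<open>C \<in> ?F\<close> by (auto simp: CL_def)
    then show ?thesis
    proof cases
      case (arc a b)
      then obtain p1 p2 where p: "p = p1 @ (a, b) # p2"
        by (auto dest: split_list)
      let ?S = "set (pawalk_verts x p1)" and ?T = "set (pawalk_verts b p2)"
      note walks = pcas_append_Cons[OF walk[unfolded p]]
      \<comment> \<open>Any arc that starts in \<open>?S\<close>, other than the cut one, now
        belongs to \<open>p1\<close> and so ends in \<open>?S\<close>.\<close>
      have disj: "?S \<inter> ?T = {}"
        using dist unfolding p walks(3) by auto
      show ?thesis
      proof (rule cut[where S = ?S])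
        fix c d assume "(c, d) \<in> set p" "{compl c, d} \<noteq> C" "c \<in> ?S"
        then have "(c, d) \<in> set p1 \<or> (c, d) \<in> set p2"
          using p arc(2) by auto
        then show "d \<in> ?S"
          using disj \<open>c \<in> ?S\<close> arc_in_pawalk_verts[OF walks(1)] arc_in_pawalk_verts[OF walks(2)]
          by blast
      next
        show "x \<in> ?S"
          using walks(1) by (rule start_in_pawalk_verts)
        show "compl y \<notin> ?S"
          using disj end_in_pawalk_verts[OF walks(2)] by blast
      qed
    next
      \<comment> \<open>With \<open>{x}\<close> dropped, all vertices can be false.\<close>
      case x
      then show ?thesis
        by (intro cut[where S = "{}"]) auto
    next
      \<comment> \<open>With \<open>{y}\<close> dropped, all vertices can be true, as every arc ends
        in \<open>?V\<close>.\<close>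
      case y
      then show ?thesis
        using arc_in_pawalk_verts(2)[OF walk] ends by (intro cut[where S = ?V]) blast+
    qed
  qed
  then show ?thesis
    using path_clauses_unsat[OF walk] unfolding minimally_unsat_def by blast
qed

section \<open>Recovering a path from its clauses\<close>

text \<open>The clause \<open>{compl u, b}\<close> stems from \<open>(u, b)\<close> or from the
  contrapositive arc \<open>(compl b, compl u)\<close>. The latter ends outside \<open>V\<close>
  once \<open>u\<close> is in \<open>V\<close>, so \<open>A\<close> contains the former, and the
  next vertex \<open>b\<close> is in \<open>V\<close> again.\<close>

lemma walk_within:
  assumes "pcas u q w" "u \<in> V" "complement_free V" "A \<subseteq> V \<times> V" "CL (set q) \<subseteq> CL A"
  shows "set q \<subseteq> A \<and> set (pawalk_verts u q) \<subseteq> V"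
  using assms
proof (induction u q w rule: pcas.induct)
  case (2 u e q w)
  obtain b where e: "e = (u, b)"
    using 2(2) by (cases e) auto
  have "{compl u, b} \<in> CL (set (e # q))"
    by (auto simp: CL_def e)
  then have "{compl u, b} \<in> CL A"
    using 2(6) by blast
  then obtain c d where cd: "(c, d) \<in> A" "{compl u, b} = {compl c, d}"
    by (auto simp: CL_def)
  have "compl u \<notin> V" "c \<in> V" "d \<in> V"
    using 2(3,4,5) cd(1) by (auto simp: complement_free_def)
  then have "compl u = compl c" "b = d"
    using cd(2) by (auto simp: doubleton_eq_iff)
  then have "(u, b) \<in> A"
    using cd(1) by (metis compl_compl)
  moreover have "CL (set q) \<subseteq> CL A"
    using 2(6) CL_mono[of "set q" "set (e # q)"] by auto
  moreover have "b \<in> V"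
    using calculation(1) 2(5) by auto
  ultimately show ?case
    using 2 e by auto
qed simp

lemma regular_walk_within:
  assumes p: "pcas x p (compl y)" "complement_free (set (pawalk_verts x p))"
    and q: "pcas x q (compl y)" "complement_free (set (pawalk_verts x q))"
    and eq: "CL (set q) \<union> {{x}, {y}} = CL (set p) \<union> {{x}, {y}}"
  shows "set q \<subseteq> set p \<and> set (pawalk_verts x q) \<subseteq> set (pawalk_verts x p)"
proof (rule walk_within[OF q(1) start_in_pawalk_verts[OF p(1)] p(2)])
  show "set p \<subseteq> set (pawalk_verts x p) \<times> set (pawalk_verts x p)"
    using arc_in_pawalk_verts[OF p(1)] by auto
  \<comment> \<open>A unit clause would force \<open>b = compl a\<close>, two complementary vertices
    on the regular path \<open>q\<close>. Hence the adjoined unit clauses can be cancelled from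
    \<open>eq\<close>.\<close>
  have "{compl a, b} \<noteq> {z}" if "(a, b) \<in> set q" for a b z
    using arc_in_pawalk_verts[OF q(1) that] q(2) by (auto simp: complement_free_def)
  then have "CL (set q) \<inter> {{x}, {y}} = {}"
    by (auto simp: CL_def)
  then show "CL (set q) \<subseteq> CL (set p)"
    using eq by blast
qed

text \<open>Paths are compared as subdigraphs, so mutual inclusion of arcs and vertices suffices;
  the order of the arcs need not be matched.\<close>

lemma regular_path_unique:
  assumes "P \<in> regular_paths G x (compl y)" "Q \<in> regular_paths G x (compl y)"
    and "CL (parcs P) \<union> {{x}, {y}} = CL (parcs Q) \<union> {{x}, {y}}"
  shows "P = Q"
proof -
  obtain p q where
    p: "P = walk_digraph x p" "pcas x p (compl y)" "complement_free (set (pawalk_verts x p))" and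
    q: "Q = walk_digraph x q" "pcas x q (compl y)" "complement_free (set (pawalk_verts x q))"
    using assms(1,2) by (elim regular_pathE)
  have eq: "CL (set p) \<union> {{x}, {y}} = CL (set q) \<union> {{x}, {y}}"
    using assms(3) p(1) q(1) by (simp add: walk_digraph_def)
  show ?thesis
    using regular_walk_within[OF p(2,3) q(2,3) eq[symmetric]]
      regular_walk_within[OF q(2,3) p(2,3) eq] p(1) q(1)
    by (auto simp: walk_digraph_def)
qed

section \<open>From minimally unsatisfiable clause-sets to regular paths\<close>

lemma lit_true_reachable:
  assumes "x \<rightarrow>\<^sup>*\<^bsub>with_proj (idg H)\<^esub> l" "lit_true \<tau> x" "\<forall>C\<in>H. \<exists>l\<in>C. lit_true \<tau> l"
  shows "lit_true \<tau> l"
proof -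
  interpret pair_wf_digraph "idg H"
    by (rule pair_wf_digraph_idg)
  obtain p where "set p \<subseteq> parcs (idg H)" "pcas x p l"
    using assms(1) unfolding reachable_apath apath_with_proj_iff by blast
  moreover have "CL (set p) \<subseteq> H"
    using calculation(1) CL_mono CL_parcs_idg_subset by blast
  ultimately show ?thesis
    using lit_true_along_walk assms(2,3) by blast
qed

lemma minimally_unsat_regular_path:
  assumes mu: "minimally_unsat G"
    and card: "\<forall>C\<in>G. card C = 1 \<or> card C = 2"
    and x: "{x} \<in> G" and y: "{y} \<in> G" and neq: "x \<noteq> y"
  obtains p where "pre_digraph.apath (with_proj (idg G)) x p (compl y)"
    and "complement_free (set (pawalk_verts x p))"
proof -
  \<comment> \<open>Since \<open>x \<noteq> y\<close>, the clause \<open>{x}\<close> survives in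
    \<open>?H\<close>: this makes \<open>x\<close> a vertex of the digraph and true in every model
    of \<open>?H\<close>.\<close>
  let ?H = "G - {{y}}"
  interpret pair_wf_digraph "idg ?H"
    by (rule pair_wf_digraph_idg)
  define R where "R = {l. x \<rightarrow>\<^sup>*\<^bsub>with_proj (idg ?H)\<^esub> l}"
  have "x \<in> pverts (idg ?H)"
    using x neq by (force simp: idg_def vars_def)
  then have xR: "x \<in> R"
    by (simp add: R_def)
  have R_step: "b \<in> R" if "{a, b} \<in> ?H" "compl a \<in> R" for a b
  proof -
    have "(compl a, b) \<in> parcs (idg ?H)"
      using that(1) unfolding parcs_idg by blast
    then show ?thesis
      using that(2) reachable_adj_trans unfolding R_def by simp
  qed
  have "satisfiable ?H"
    using mu y unfolding minimally_unsat_def by blast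
  then obtain \<tau> where \<tau>: "\<forall>C\<in>?H. \<exists>l\<in>C. lit_true \<tau> l"
    unfolding satisfiable_def by blast
  have "lit_true \<tau> x"
    using \<tau>[rule_format, of "{x}"] x neq by simp
  then have R_true: "lit_true \<tau> l" if "l \<in> R" for l
    using lit_true_reachable \<tau> that unfolding R_def by blast
  have R_free: "complement_free R"
    unfolding complement_free_def
  proof (intro ballI notI)
    fix l assume "l \<in> R" "compl l \<in> R"
    then show False
      using R_true[of l] R_true[of "compl l"] by simp
  qed
  have "compl y \<in> R"
  proof (rule ccontr)
    assume contra: "compl y \<notin> R"
    have "satisfiable (G - {{x}})"
      using mu x unfolding minimally_unsat_def by blast
    then obtain \<sigma> where \<sigma>: "\<forall>C\<in>G - {{x}}. \<exists>l\<in>C. lit_true \<sigma> l"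
      unfolding satisfiable_def by blast
    obtain \<rho> where in_R: "\<And>l. l \<in> R \<Longrightarrow> lit_true \<rho> l \<longleftrightarrow> l \<in> R"
      and off_R: "\<And>l. l \<notin> R \<Longrightarrow> compl l \<notin> R \<Longrightarrow> lit_true \<rho> l \<longleftrightarrow> lit_true \<sigma> l"
      using ex_valuation_override[OF R_free, of R \<sigma>] by metis
    have "\<exists>l\<in>C. lit_true \<rho> l" if "C \<in> G" for C
    proof (cases "\<exists>l\<in>C. l \<in> R")
      case False
      then have "C \<noteq> {x}"
        using xR by auto
      then obtain l where l: "l \<in> C" "lit_true \<sigma> l"
        using \<sigma> \<open>C \<in> G\<close> by blast
      \<comment> \<open>This is what lets \<open>\<rho>\<close> inherit the truth of
        \<open>l\<close> from \<open>\<sigma>\<close>. Otherwise \<open>R_step\<close> would put the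
        other literal of \<open>C\<close> (or \<open>l\<close> itself, if \<open>C\<close> is a
        unit) into \<open>R\<close>. Only \<open>{y}\<close> yields no arc in \<open>?H\<close>;
        there \<open>contra\<close> applies.\<close>
      have "compl l \<notin> R"
      proof (cases "C = {y}")
        case True
        then show ?thesis
          using l(1) contra by simp
      next
        case False': False
        have "card C = 1 \<or> card C = 2"
          using card \<open>C \<in> G\<close> by blast
        then obtain a b where "C = {a, b}"
          by (metis card_1_singletonE card_2_iff insert_absorb2)
        then obtain m where m: "C = {l, m}"
          using l(1) by blast
        have "m \<notin> R"
          using False m by blast
        moreover have "{l, m} \<in> ?H"
          using \<open>C \<in> G\<close> False' m by blast
        ultimately show ?thesis
          using R_step by blast
      qed
      then show ?thesis
        using off_R l False by blast
    qed (use in_R in blast)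
    then have "satisfiable G"
      unfolding satisfiable_def by blast
    then show False
      using mu unfolding minimally_unsat_def by blast
  qed
  then obtain p where p: "apath x p (compl y)"
    unfolding R_def reachable_apath by blast
  \<comment> \<open>Each vertex ends an initial segment of the path, hence is itself reachable from
    \<open>x\<close>.\<close>
  have "set (pawalk_verts x p) \<subseteq> R"
  proof
    fix l assume "l \<in> set (pawalk_verts x p)"
    then obtain q where "awalk x q l"
      using awalk_decomp[OF awalkI_apath[OF p]] by metis
    then show "l \<in> R"
      unfolding R_def using reachable_awalkI by simp
  qed
  then have "complement_free (set (pawalk_verts x p))"
    using R_free by (auto simp: complement_free_def)
  moreover have "pre_digraph.apath (with_proj (idg G)) x p (compl y)"
    using p idg_mono[of ?H G] unfolding apath_with_proj_iff by blast
  ultimately show thesis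
    using that by blast
qed

theorem theorem6p1:
  fixes F :: "'v clause_set" and x y :: "'v lit"
  assumes "is_clause_set F"
    and "\<forall>C\<in>F. card C = 1 \<or> card C = 2"
    and "{x} \<in> F" and "{y} \<in> F" and "{x} \<noteq> {y}"
  shows "bij_betw (\<lambda>P. CL (parcs P) \<union> {{x}, {y}})
           (regular_paths (idg F) x (compl y))
           {G. G \<subseteq> F \<and> minimally_unsat G \<and> {x} \<in> G \<and> {y} \<in> G}"
    (is "bij_betw ?f ?P ?M")
proof (rule bij_betwI')
  show "?f P = ?f Q \<longleftrightarrow> P = Q" if "P \<in> ?P" "Q \<in> ?P" for P Q
    using regular_path_unique[OF that] by auto
next
  fix P assume "P \<in> ?P"
  then obtain p where p: "P = walk_digraph x p" "set p \<subseteq> parcs (idg F)" "pcas x p (compl y)"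
    "distinct (pawalk_verts x p)" "complement_free (set (pawalk_verts x p))"
    by (rule regular_pathE)
  have "CL (set p) \<subseteq> F"
    using CL_mono[OF p(2)] CL_parcs_idg_subset by blast
  then show "?f P \<in> ?M"
    using path_clauses_minimally_unsat[OF p(3-5)] assms(3,4) p(1) by (simp add: walk_digraph_def)
next
  fix G assume "G \<in> ?M"
  then have G: "G \<subseteq> F" "minimally_unsat G" "{x} \<in> G" "{y} \<in> G"
    by auto
  moreover have "\<forall>C\<in>G. card C = 1 \<or> card C = 2" "x \<noteq> y"
    using assms(2,5) G(1) by auto
  ultimately obtain p where p: "pre_digraph.apath (with_proj (idg G)) x p (compl y)"
    "complement_free (set (pawalk_verts x p))"
    by (blast elim: minimally_unsat_regular_path)
  \<comment> \<open>The path was found in \<open>idg G\<close>, but the domain of the bijection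
    consists of paths in \<open>idg F\<close>.\<close>
  have "pre_digraph.apath (with_proj (idg F)) x p (compl y)"
    using p(1) idg_mono[OF G(1)] unfolding apath_with_proj_iff by blast
  then have "walk_digraph x p \<in> ?P"
    using p(2) by (auto simp: regular_paths_def paths_def walk_digraph_def)
  moreover have "CL (set p) \<union> {{x}, {y}} = G"
  proof (rule minimally_unsat_subset_eq[OF G(2)])
    have walk: "set p \<subseteq> parcs (idg G)" "pcas x p (compl y)"
      using p(1) unfolding apath_with_proj_iff by auto
    show "CL (set p) \<union> {{x}, {y}} \<subseteq> G"
      using CL_mono[OF walk(1)] CL_parcs_idg_subset G(3,4) by blast
    show "\<not> satisfiable (CL (set p) \<union> {{x}, {y}})"
      by (rule path_clauses_unsat[OF walk(2)])
  qed
  ultimately show "\<exists>P\<in>?P. G = ?f P"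
    by (auto simp: walk_digraph_def intro!: bexI[of _ "walk_digraph x p"])
qed

end
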